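(* Suppose Assumptions 1 and 2 (listed in the context) hold. Let $\{x^k\}$ be the sequence generated by the VBPG method and let $\bar{x}$ be an accumulation point of $\{x^k\}$. Assume that the level-set subdifferential error bound holds at $\bar{x}$ with exponent $\gamma\in(0,1]$ and some $\eta>0$, $\nu>0$. Then there exists $k_0'>0$ such that the value proximity error bound (VP-EB) holds at $\bar{x}$ for all $k\ge k_0'$; that is, there exist $\kappa',\eta',\nu'>0$ such that $$F(x^{k+1})-F(\bar x)\le\kappa'\|x^k-x^{k+1}\|^2\quad\text{for all }k\ge k_0'\text{ with }x^{k+1}\in\mathfrak{B}(\bar x;\eta',\nu').$$
   Context: $\langle\cdot,\cdot\rangle,\|\cdot\|$ are the Euclidean inner product and norm on $\mathbb{R}^n$; $\mathrm{dist}(x,C)=\inf_{z\in C}\|x-z\|$, $\mathrm{dist}(x,\emptyset)=\infty$; $\mathbb{B}(\bar x;\eta)$ is the open ball. $F=f+g$, $\bar F=F(\bar x)$, $[F\le\bar F]=\{x:F(x)\le\bar F\}$, $\mathfrak{B}(\bar x;\eta,\nu)=\mathbb{B}(\bar x;\eta)\cap\{x:\bar F<F(x)<\bar F+\nu\}$. Assumption 1: (i) $f:\mathbb{R}^n\to(-\infty,\infty]$ is proper lower semicontinuous (l.s.c.), differentiable on $\mathrm{dom} f$, $\mathrm{dom} f$ is convex, and $\nabla f$ is $L$-Lipschitz ($L>0$); (ii) $g:\mathbb{R}^n\to(-\infty,\infty]$ is proper l.s.c. and $\mathrm{dom}\,g$ is convex; (iii) $F$ is level-bounded: $\{x: F(x)\le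 r\}$ is bounded (possibly empty) for every $r\in\mathbb{R}$. Assumption 2: for each $k\in\mathbb{N}$, $K^k:\mathbb{R}^n\to\mathbb{R}$ is differentiable, strongly convex with uniform modulus $m>0$, and $\nabla K^k$ is uniformly $M$-Lipschitz; $0<\underline{\epsilon}\le\epsilon^k\le\overline{\epsilon}$ for all $k$. Bregman distances: $D^k(x,y)=K^k(y)-[K^k(x)+\langle\nabla K^k(x),y-x\rangle]$. VBPG method: from an initial point $x^0$, for all $k\ge0$, $x^{k+1}\in\operatorname{argmin}_{x\in\mathbb{R}^n}\{\langle\nabla f(x^k),x-x^k\rangle+g(x)+\frac{1}{\epsilon^k}D^k(x^k,x)\}$. ($f$ is understood to be finite and differentiable where $\nabla f$ is used.) Proximal subdifferential: for $\bar x\in\mathrm{dom}\,\psi$, $\partial_P\psi(\bar x)$ is the set of $\xi$ for which there are $\rho>0,\delta>0$ with $\psi(x)\ge\psi(\bar x)+\langle\xi,x-\bar x\rangle-\rho\|x-\bar x\|^2$ whenever $\|x-\bar x\|<\delta$. Level-set subdifferential error bound at $\bar x$ with exponent $\gamma>0$ and $\eta,\nu>0$: there is $c_1>0$ with $\mathrm{dist}^\gamma(x,[F\le\bar F])\le c_1\,\mathrm{dist}(0,\partial_PF(x))$ for all $x\in\mathfrak{B}(\bar x;\eta,\nu)$. *)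

theory Defs
  imports "HOL-Analysis.Analysis"
begin

definition edom :: "('a \<Rightarrow> ereal) \<Rightarrow> 'a set" where
  "edom \<psi> = {x. \<psi> x < \<infinity>}"

definition proper :: "('a \<Rightarrow> ereal) \<Rightarrow> bool" where
  "proper \<psi> \<longleftrightarrow> (\<forall>x. \<psi> x \<noteq> -\<infinity>) \<and> edom \<psi> \<noteq> {}"

definition lsc :: "('a::topological_space \<Rightarrow> ereal) \<Rightarrow> bool" where
  "lsc \<psi> \<longleftrightarrow> (\<forall>x. \<psi> x \<le> Liminf (at x) \<psi>)"

definition level_bounded :: "('a::metric_space \<Rightarrow> ereal) \<Rightarrow> bool" where
  "level_bounded \<psi> \<longleftrightarrow> (\<forall>r::real. bounded {x. \<psi> x \<le> ereal r})"

(* "dh is the gradient of h on S".  The derivative is taken within S: for an extended-valued f with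
   S = dom f, the function real_of_ereal o f has the junk value 0 outside S, and it must not be
   consulted.  On an open S this is the ordinary gradient. *)
definition gradient_on :: "('a::real_inner \<Rightarrow> real) \<Rightarrow> ('a \<Rightarrow> 'a) \<Rightarrow> 'a set \<Rightarrow> bool" where
  "gradient_on h dh S \<longleftrightarrow>
     (\<forall>x\<in>S. (h has_derivative (\<lambda>v. dh x \<bullet> v)) (at x within S))"

definition strongly_convex :: "real \<Rightarrow> ('a::real_normed_vector \<Rightarrow> real) \<Rightarrow> bool" where
  "strongly_convex m h \<longleftrightarrow>
     (\<forall>x y. \<forall>t\<in>{0..1}. h (t *\<^sub>R x + (1 - t) *\<^sub>R y)
        \<le> t * h x + (1 - t) * h y - m / 2 * t * (1 - t) * (norm (x - y))\<^sup>2)"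

definition bregman :: "('a::real_inner \<Rightarrow> real) \<Rightarrow> ('a \<Rightarrow> 'a) \<Rightarrow> 'a \<Rightarrow> 'a \<Rightarrow> real" where
  "bregman h dh x y = h y - (h x + dh x \<bullet> (y - x))"

definition prox_subdiff :: "('a::real_inner \<Rightarrow> ereal) \<Rightarrow> 'a \<Rightarrow> 'a set" where
  "prox_subdiff \<psi> x = {\<xi>. x \<in> edom \<psi> \<and>
     (\<exists>\<rho>>0. \<exists>\<delta>>0. \<forall>y. norm (y - x) < \<delta> \<longrightarrow>
        \<psi> y \<ge> \<psi> x + ereal (\<xi> \<bullet> (y - x)) - ereal (\<rho> * (norm (y - x))\<^sup>2))}"

(* Unlike infdist, this gives distance \<infinity> to the empty set; the error bound below relies on
   that at points where the subdifferential is empty. *)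
definition edist_set :: "'a::real_normed_vector \<Rightarrow> 'a set \<Rightarrow> ereal" where
  "edist_set x C = (INF z\<in>C. ereal (norm (x - z)))"

definition epowr :: "ereal \<Rightarrow> real \<Rightarrow> ereal" where
  "epowr a \<gamma> = (if a = \<infinity> then \<infinity> else ereal (real_of_ereal a powr \<gamma>))"

definition level_nbhd :: "('a::metric_space \<Rightarrow> ereal) \<Rightarrow> 'a \<Rightarrow> real \<Rightarrow> real \<Rightarrow> 'a set" where
  "level_nbhd F xbar \<eta> \<nu> = ball xbar \<eta> \<inter> {x. F xbar < F x \<and> F x < F xbar + ereal \<nu>}"

definition level_set_subdiff_EB ::
  "('a::real_inner \<Rightarrow> ereal) \<Rightarrow> 'a \<Rightarrow> real \<Rightarrow> real \<Rightarrow> real \<Rightarrow> bool" where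
  "level_set_subdiff_EB F xbar \<gamma> \<eta> \<nu> \<longleftrightarrow>
     (\<exists>c>0. \<forall>x\<in>level_nbhd F xbar \<eta> \<nu>.
        epowr (edist_set x {z. F z \<le> F xbar}) \<gamma>
          \<le> ereal c * edist_set 0 (prox_subdiff F x))"

definition VBPG_sequence ::
  "('a::real_inner \<Rightarrow> 'a) \<Rightarrow> ('a \<Rightarrow> ereal) \<Rightarrow> (nat \<Rightarrow> 'a \<Rightarrow> real) \<Rightarrow> (nat \<Rightarrow> 'a \<Rightarrow> 'a)
     \<Rightarrow> (nat \<Rightarrow> real) \<Rightarrow> (nat \<Rightarrow> 'a) \<Rightarrow> bool" where
  "VBPG_sequence df g K dK \<epsilon> x \<longleftrightarrow>
     (\<forall>k. is_arg_min
        (\<lambda>y. ereal (df (x k) \<bullet> (y - x k)) + g y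
              + ereal (1 / \<epsilon> k * bregman (K k) (dK k) (x k) y))
        (\<lambda>_. True) (x (Suc k)))"

definition accumulation_point :: "(nat \<Rightarrow> 'a::topological_space) \<Rightarrow> 'a \<Rightarrow> bool" where
  "accumulation_point x a \<longleftrightarrow> (\<exists>r. strict_mono r \<and> (x \<circ> r) \<longlonglongrightarrow> a)"

end

theory Submission
  imports Defs
begin

text \<open>Write r for the length of the k-th step and y for its endpoint. The minimality of y, together
  with the quadratic bounds for f and K that Lipschitz gradients provide, gives the global inequality
  F z \<ge> F y + \<langle>\<xi>, z - y\<rangle> - (C/2) \<parallel>z - y\<parallel>^2 with \<parallel>\<xi>\<parallel> \<le> C r. It is used twice: it says that \<xi>
  is a proximal subgradient at y, so the error bound yields d^\<gamma> \<le> c C r for the distance d from y to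
  the level set; and taking the infimum over z in the level set it yields
  F y - F xbar \<le> C (r^2 + d^2). If r \<le> 1, then d is at most a constant times r because
  1 / \<gamma> \<ge> 1. If r > 1, the bound F y - F xbar < \<nu> is already at most \<nu> r^2, so no convergence
  of the step lengths to 0 is required.\<close>

text \<open>Along the segment from \<open>x\<close> to \<open>y\<close>, the slope of
  \<open>h\<close> exceeds its initial value by at most \<open>L * t\<close> times the squared
  length, by Cauchy-Schwarz and the Lipschitz bound. Integrating this over the segment produces the
  factor \<open>L / 2\<close>.\<close>

lemma gradient_on_upper_quadratic:
  fixes h :: "'a::real_inner \<Rightarrow> real"
  assumes grad: "gradient_on h dh S" and lip: "L-lipschitz_on S dh" and S: "convex S"
    and x: "x \<in> S" and y: "y \<in> S"
  shows "h y \<le> h x + dh x \<bullet> (y - x) + L / 2 * (norm (y - x))\<^sup>2"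
proof -
  define v where "v = y - x"
  define p where "p t = x + t *\<^sub>R v" for t :: real
  have pS: "p t \<in> S" if "t \<in> {0..1}" for t
  proof -
    have "p t = (1 - t) *\<^sub>R x + t *\<^sub>R y"
      by (simp add: p_def v_def algebra_simps)
    then show ?thesis
      using that convexD_alt[OF S x y, of t] by simp
  qed
  \<comment> \<open>The quadratic model is subtracted from \<open>h\<close> along the segment, up to
    the constant \<open>h x\<close>, so that \<open>q 1 \<le> q 0\<close> is the claim and
    monotonicity replaces integration.\<close>
  define q where "q t = h (p t) - t * (dh x \<bullet> v) - L / 2 * t\<^sup>2 * (norm v)\<^sup>2" for t
  have q': "(q has_real_derivative (dh (p t) - dh x) \<bullet> v - L * t * (norm v)\<^sup>2) (at t within {0..1})"
    if t: "t \<in> {0..1}" for t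
  proof -
    \<comment> \<open>\<open>S\<close> may fail to be open, so the derivative is restricted to the
      segment, where the chain rule within sets applies.\<close>
    have "(h has_derivative (\<lambda>w. dh (p t) \<bullet> w)) (at (p t) within p ` {0..1})"
      using grad pS t unfolding gradient_on_def
      by (meson has_derivative_subset image_subsetI)
    moreover have "(p has_derivative (\<lambda>s. s *\<^sub>R v)) (at t within {0..1})"
      unfolding p_def by (auto intro!: derivative_eq_intros)
    ultimately have "((\<lambda>t. h (p t)) has_derivative (\<lambda>s. dh (p t) \<bullet> (s *\<^sub>R v))) (at t within {0..1})"
      using has_derivative_in_compose by blast
    then have hp: "((\<lambda>t. h (p t)) has_real_derivative dh (p t) \<bullet> v) (at t within {0..1})"
      by (simp add: has_field_derivative_def mult_commute_abs)
    show ?thesis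
      unfolding q_def
      by (auto intro!: derivative_eq_intros hp simp: inner_diff_left)
  qed
  have "q 1 \<le> q 0"
  proof (rule DERIV_nonpos_imp_decreasing_open[of 0 1 q])
    show "continuous_on {0..1} q"
      by (rule DERIV_continuous_on[OF q'])
    fix t :: real assume t: "0 < t" "t < 1"
    then have "at t within {0..1} = at t"
      by (simp add: at_within_Icc_at)
    then have "(q has_real_derivative (dh (p t) - dh x) \<bullet> v - L * t * (norm v)\<^sup>2) (at t)"
      using q'[of t] t by simp
    moreover have "(dh (p t) - dh x) \<bullet> v \<le> L * t * (norm v)\<^sup>2"
    proof -
      have "(dh (p t) - dh x) \<bullet> v \<le> norm (dh (p t) - dh x) * norm v"
        by (rule norm_cauchy_schwarz)
      also have "\<dots> \<le> (L * norm (p t - x)) * norm v"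
        using lipschitz_onD[OF lip pS[of t] x] t by (intro mult_right_mono) (auto simp: dist_norm)
      also have "\<dots> = L * t * (norm v)\<^sup>2"
        using t by (simp add: p_def power2_eq_square)
      finally show ?thesis .
    qed
    ultimately show "\<exists>d. (q has_real_derivative d) (at t) \<and> d \<le> 0"
      by force
  qed simp
  then show ?thesis
    by (simp add: q_def p_def v_def)
qed

text \<open>This is the upper bound applied to \<open>- h\<close>, whose gradient has the same
  Lipschitz constant.\<close>

lemma gradient_on_lower_quadratic:
  fixes h :: "'a::real_inner \<Rightarrow> real"
  assumes grad: "gradient_on h dh S" and lip: "L-lipschitz_on S dh" and S: "convex S"
    and x: "x \<in> S" and y: "y \<in> S"
  shows "h x + dh x \<bullet> (y - x) - L / 2 * (norm (y - x))\<^sup>2 \<le> h y"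
proof -
  have "gradient_on (\<lambda>z. - h z) (\<lambda>z. - dh z) S"
    using grad unfolding gradient_on_def by (auto intro!: derivative_eq_intros)
  moreover have "L-lipschitz_on S (\<lambda>z. - dh z)"
    using lip by simp
  ultimately show ?thesis
    using gradient_on_upper_quadratic[OF _ _ S x y] by fastforce
qed

text \<open>Three inequalities are added: minimality of \<open>y\<close> against \<open>z\<close>,
  the lower quadratic bound for \<open>f\<close> at \<open>y\<close>, and the upper one for
  \<open>K\<close> at \<open>y\<close>. Their linear terms combine into the subgradient candidate.
  The bound is global in \<open>z\<close>, so it can also be tested at points of a level set far
  from \<open>y\<close>.\<close>

lemma prox_step_global_bound:
  fixes f g :: "'a::real_inner \<Rightarrow> ereal"
  assumes f: "proper f" "convex (edom f)"
      "gradient_on (\<lambda>z. real_of_ereal (f z)) df (edom f)" "L-lipschitz_on (edom f) df"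
    and g: "proper g"
    and K: "gradient_on K dK UNIV" "M-lipschitz_on UNIV dK"
    and e: "0 < e"
    and y: "y \<in> edom f"
      "is_arg_min (\<lambda>z. ereal (df x \<bullet> (z - x)) + g z + ereal (1 / e * bregman K dK x z)) (\<lambda>_. True) y"
  shows "y \<in> edom g"
    and "f y + g y + ereal ((df y - df x - (1 / e) *\<^sub>R (dK y - dK x)) \<bullet> (z - y))
           - ereal ((L + M / e) / 2 * (norm (z - y))\<^sup>2) \<le> f z + g z"
proof -
  let ?obj = "\<lambda>z. ereal (df x \<bullet> (z - x)) + g z + ereal (1 / e * bregman K dK x z)"
  have min: "?obj y \<le> ?obj z" for z
    using y(2) by (auto simp: is_arg_min_def not_less)
  have fin: "\<bar>f z\<bar> \<noteq> \<infinity>" if "z \<in> edom f" for z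
    using f(1) that by (auto simp: proper_def edom_def)
  have ging: "\<bar>g z\<bar> \<noteq> \<infinity>" if "z \<in> edom g" for z
    using g that by (auto simp: proper_def edom_def)
  obtain z0 where "z0 \<in> edom g"
    using g by (auto simp: proper_def)
  then have "?obj z0 < \<infinity>"
    by (auto simp: edom_def)
  then have "?obj y < \<infinity>"
    using min[of z0] by (rule le_less_trans[rotated])
  then show yg: "y \<in> edom g"
    by (auto simp: edom_def)
  show "f y + g y + ereal ((df y - df x - (1 / e) *\<^sub>R (dK y - dK x)) \<bullet> (z - y))
           - ereal ((L + M / e) / 2 * (norm (z - y))\<^sup>2) \<le> f z + g z"
  proof (cases "z \<in> edom f \<and> z \<in> edom g")
    \<comment> \<open>\<open>proper\<close> excludes \<open>-\<infinity>\<close>, so one infinite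
      summand makes the right-hand side \<open>\<infinity>\<close>.\<close>
    case False
    then have "f z + g z = \<infinity>"
      using f(1) g by (auto simp: edom_def proper_def)
    then show ?thesis by (simp only: ereal_less_eq)
  next
    case True
    obtain fy fz gy gz where r: "f y = ereal fy" "f z = ereal fz" "g y = ereal gy" "g z = ereal gz"
      using fin[of y] fin[of z] ging[of y] ging[of z] True y(1) yg by (metis ereal_real')
    have 1: "fy + df y \<bullet> (z - y) - L / 2 * (norm (z - y))\<^sup>2 \<le> fz"
      using gradient_on_lower_quadratic[OF f(3,4,2) y(1), of z] True r by simp
    have "K z \<le> K y + dK y \<bullet> (z - y) + M / 2 * (norm (z - y))\<^sup>2"
      using gradient_on_upper_quadratic[OF K(1,2)] by simp
    then have "(1 / e) * (K z - K y) \<le> (1 / e) * (dK y \<bullet> (z - y) + M / 2 * (norm (z - y))\<^sup>2)"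
      using e by (intro mult_left_mono) auto
    then have 2: "1 / e * K z - 1 / e * K y
        \<le> 1 / e * (dK y \<bullet> (z - y)) + M / e / 2 * (norm (z - y))\<^sup>2"
      by (simp add: algebra_simps)
    have "df x \<bullet> (y - x) + gy + 1 / e * bregman K dK x y
        \<le> df x \<bullet> (z - x) + gz + 1 / e * bregman K dK x z"
      using min[of z] r by simp
    moreover have "df x \<bullet> (z - x) = df x \<bullet> (z - y) + df x \<bullet> (y - x)"
      by (simp add: inner_diff_right)
    \<comment> \<open>Both distances have base point \<open>x\<close>, so \<open>K x\<close> cancels
      and only \<open>dK x\<close> contributes a linear term.\<close>
    moreover have "1 / e * bregman K dK x z - 1 / e * bregman K dK x y
        = 1 / e * K z - 1 / e * K y - 1 / e * (dK x \<bullet> (z - y))"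
      by (simp add: bregman_def algebra_simps inner_diff_right)
    ultimately have "fy + gy + (df y \<bullet> (z - y) - df x \<bullet> (z - y)
          - (1 / e * (dK y \<bullet> (z - y)) - 1 / e * (dK x \<bullet> (z - y))))
        - (L / 2 * (norm (z - y))\<^sup>2 + M / e / 2 * (norm (z - y))\<^sup>2) \<le> fz + gz"
      using 1 2 by linarith
    moreover have "(df y - df x - (1 / e) *\<^sub>R (dK y - dK x)) \<bullet> (z - y) = df y \<bullet> (z - y) - df x \<bullet> (z - y)
          - (1 / e * (dK y \<bullet> (z - y)) - 1 / e * (dK x \<bullet> (z - y)))"
      by (simp add: inner_diff_left right_diff_distrib)
    moreover have "(L + M / e) / 2 * (norm (z - y))\<^sup>2
        = L / 2 * (norm (z - y))\<^sup>2 + M / e / 2 * (norm (z - y))\<^sup>2"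
      by (simp add: algebra_simps add_divide_distrib)
    ultimately have "fy + gy + (df y - df x - (1 / e) *\<^sub>R (dK y - dK x)) \<bullet> (z - y)
        - (L + M / e) / 2 * (norm (z - y))\<^sup>2 \<le> fz + gz"
      by linarith
    then show ?thesis
      unfolding r by simp
  qed
qed

text \<open>Testing the inequality at a level-set point at distance \<open>s\<close> from
  \<open>y\<close> gives \<open>b - a \<le> C * (r * s + s\<^sup>2 / 2)\<close>. The mixed term is
  absorbed into squares, and the infimum over such points turns \<open>s\<close> into
  \<open>d\<close>; no nearest point has to exist.\<close>

lemma level_set_gap_le:
  fixes F :: "'a::real_inner \<Rightarrow> ereal"
  assumes C: "C > 0" and r: "norm \<xi> \<le> C * r"
    and sub: "\<And>z. F y + ereal (\<xi> \<bullet> (z - y)) - ereal (C / 2 * (norm (z - y))\<^sup>2) \<le> F z"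
    and Fy: "F y = ereal b" and d: "edist_set y {z. F z \<le> ereal a} = ereal d"
  shows "b - a \<le> C * (r\<^sup>2 + d\<^sup>2)"
proof -
  have "(b - a) / C - r\<^sup>2 \<le> (norm (y - z))\<^sup>2" if z: "F z \<le> ereal a" for z
  proof -
    define s where "s = norm (y - z)"
    have "F y + ereal (\<xi> \<bullet> (z - y)) - ereal (C / 2 * (norm (z - y))\<^sup>2) \<le> ereal a"
      using sub[of z] z by (rule order_trans)
    then have "b + \<xi> \<bullet> (z - y) - C / 2 * s\<^sup>2 \<le> a"
      by (simp add: Fy s_def norm_minus_commute)
    moreover have "\<bar>\<xi> \<bullet> (z - y)\<bar> \<le> C * r * s"
    proof -
      have "\<bar>\<xi> \<bullet> (z - y)\<bar> \<le> norm \<xi> * norm (z - y)"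
        by (rule Cauchy_Schwarz_ineq2)
      also have "\<dots> \<le> C * r * s"
        unfolding s_def using r by (simp add: norm_minus_commute mult_right_mono)
      finally show ?thesis .
    qed
    ultimately have "b - a \<le> C * (r * s + s\<^sup>2 / 2)"
      by (simp add: algebra_simps)
    also have "\<dots> \<le> C * (r\<^sup>2 + s\<^sup>2)"
    proof (intro mult_left_mono)
      \<comment> \<open>Half of this expression is the right side minus the left side of the
        goal.\<close>
      have "0 \<le> (r - s)\<^sup>2 + r\<^sup>2" by simp
      then show "r * s + s\<^sup>2 / 2 \<le> r\<^sup>2 + s\<^sup>2"
        by (simp add: power2_eq_square algebra_simps)
    qed (use C in simp)
    finally show ?thesis
      using C by (simp add: s_def field_simps)
  qed
  \<comment> \<open>The infimum runs over norms, not their squares, hence the root. A negative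
    radicand is harmless, as \<open>sqrt\<close> is then negative.\<close>
  then have "ereal (sqrt ((b - a) / C - r\<^sup>2)) \<le> edist_set y {z. F z \<le> ereal a}"
    unfolding edist_set_def by (intro INF_greatest) (auto intro: real_le_lsqrt)
  then have "(b - a) / C - r\<^sup>2 \<le> d\<^sup>2"
    by (simp add: d sqrt_le_D)
  then show ?thesis
    using C by (simp add: field_simps)
qed

text \<open>Taking the power \<open>1 / \<gamma>\<close> isolates \<open>d\<close>; since this
  exponent is at least 1 and \<open>r \<le> 1\<close>, the power of \<open>r\<close> is at most
  \<open>r\<close>.\<close>

lemma le_of_powr_le:
  fixes d A r \<gamma> :: real
  assumes \<gamma>: "0 < \<gamma>" "\<gamma> \<le> 1" and nn: "0 \<le> d" "0 \<le> A" "0 \<le> r" "r \<le> 1"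
    and le: "d powr \<gamma> \<le> A * r"
  shows "d \<le> A powr (1 / \<gamma>) * r"
proof -
  have "d = (d powr \<gamma>) powr (1 / \<gamma>)"
    using \<gamma> nn by (simp add: powr_powr)
  also have "\<dots> \<le> (A * r) powr (1 / \<gamma>)"
    using le \<gamma> by (intro powr_mono2) auto
  also have "\<dots> = A powr (1 / \<gamma>) * r powr (1 / \<gamma>)"
    using nn by (simp add: powr_mult)
  also have "\<dots> \<le> A powr (1 / \<gamma>) * r"
  proof (cases "r = 0")
    case False
    then have "r powr (1 / \<gamma>) \<le> r powr 1"
      using nn \<gamma> by (intro powr_mono') auto
    then show ?thesis
      using nn False by (intro mult_left_mono) auto
  qed simp
  finally show ?thesis .
qed

theorem proposition4p2:
  fixes f g F :: "real ^ 'n \<Rightarrow> ereal"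
    and df :: "real ^ 'n \<Rightarrow> real ^ 'n"
    and K :: "nat \<Rightarrow> real ^ 'n \<Rightarrow> real"
    and dK :: "nat \<Rightarrow> real ^ 'n \<Rightarrow> real ^ 'n"
    and \<epsilon> :: "nat \<Rightarrow> real"
    and x :: "nat \<Rightarrow> real ^ 'n"
    and xbar :: "real ^ 'n"
    and L m M \<epsilon>lo \<epsilon>hi \<gamma> \<eta> \<nu> :: real
  defines "F \<equiv> (\<lambda>z. f z + g z)"
  assumes f: "proper f" "lsc f" "convex (edom f)"
      "gradient_on (\<lambda>z. real_of_ereal (f z)) df (edom f)"
      "L > 0" "L-lipschitz_on (edom f) df"
    and g: "proper g" "lsc g" "convex (edom g)"
    and F: "level_bounded F"
    and K: "\<And>k. gradient_on (K k) (dK k) UNIV"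
      "m > 0" "\<And>k. strongly_convex m (K k)"
      "\<And>k. M-lipschitz_on UNIV (dK k)"
    and eps: "0 < \<epsilon>lo" "\<And>k. \<epsilon>lo \<le> \<epsilon> k" "\<And>k. \<epsilon> k \<le> \<epsilon>hi"
    and x: "VBPG_sequence df g K dK \<epsilon> x" "\<And>k. x k \<in> edom f"
    and xbar: "accumulation_point x xbar"
    and EB: "0 < \<gamma>" "\<gamma> \<le> 1" "\<eta> > 0" "\<nu> > 0" "level_set_subdiff_EB F xbar \<gamma> \<eta> \<nu>"
  shows "\<exists>k0>0. \<exists>\<kappa>'>0. \<exists>\<eta>'>0. \<exists>\<nu>'>0. \<forall>k\<ge>k0. x (Suc k) \<in> level_nbhd F xbar \<eta>' \<nu>' \<longrightarrow>
           F (x (Suc k)) - F xbar \<le> ereal (\<kappa>' * (norm (x k - x (Suc k)))\<^sup>2)"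
proof -
  have M: "0 \<le> M"
    using K(4)[of 0] by (rule lipschitz_on_nonneg)
  \<comment> \<open>Since \<open>\<epsilon>lo \<le> \<epsilon> k\<close>, this bounds
    \<open>L + M / \<epsilon> k\<close> uniformly in \<open>k\<close>, both as the quadratic modulus
    and in the estimate of \<open>norm \<xi>\<close>.\<close>
  define C where "C = L + M / \<epsilon>lo"
  have C: "C > 0"
    using f(5) M eps(1) by (simp add: C_def add_pos_nonneg)
  obtain c where c: "c > 0" and
    EBc: "\<And>y. y \<in> level_nbhd F xbar \<eta> \<nu> \<Longrightarrow>
      epowr (edist_set y {z. F z \<le> F xbar}) \<gamma> \<le> ereal c * edist_set 0 (prox_subdiff F y)"
    using EB(5) by (auto simp: level_set_subdiff_EB_def)
  define B where "B = (c * C) powr (1 / \<gamma>)"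
  \<comment> \<open>The sum majorizes the constants of both cases, \<open>\<nu>\<close> for long
    steps and \<open>C * (1 + B\<^sup>2)\<close> for short ones.\<close>
  define \<kappa> where "\<kappa> = \<nu> + C * (1 + B\<^sup>2)"
  have \<kappa>: "\<nu> \<le> \<kappa>" "C * (1 + B\<^sup>2) \<le> \<kappa>"
    using C EB(4) by (auto simp: \<kappa>_def)
  have "F (x (Suc k)) - F xbar \<le> ereal (\<kappa> * (norm (x k - x (Suc k)))\<^sup>2)"
    if nb: "x (Suc k) \<in> level_nbhd F xbar \<eta> \<nu>" for k
  proof -
    define y where "y = x (Suc k)"
    define r where "r = norm (x k - y)"
    define \<xi> where "\<xi> = df y - df (x k) - (1 / \<epsilon> k) *\<^sub>R (dK k y - dK k (x k))"
    have e: "0 < \<epsilon> k"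
      using eps(1) eps(2)[of k] by linarith
    have Me: "M / \<epsilon> k \<le> M / \<epsilon>lo"
      using M eps(1) eps(2)[of k] by (intro divide_left_mono) auto
    have yf: "y \<in> edom f"
      using x(2) by (simp add: y_def)
    have min: "is_arg_min (\<lambda>z. ereal (df (x k) \<bullet> (z - x k)) + g z
        + ereal (1 / \<epsilon> k * bregman (K k) (dK k) (x k) z)) (\<lambda>_. True) y"
      using x(1) by (simp add: VBPG_sequence_def y_def)
    note step = prox_step_global_bound[OF f(1,3,4,6) g(1) K(1) K(4) e yf min]
    have Fnm: "F z \<noteq> -\<infinity>" for z
      using f(1) g(1) by (auto simp: F_def proper_def)
    have "F xbar < F y" "F y < F xbar + ereal \<nu>"
      using nb by (auto simp: level_nbhd_def y_def)
    \<comment> \<open>The strict inequalities rule out the value \<open>\<infinity>\<close> at both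
      points, in particular at \<open>xbar\<close>.\<close>
    then obtain a b where ab: "F xbar = ereal a" "F y = ereal b" and ba: "b < a + \<nu>"
      using Fnm[of xbar] by (cases "F xbar"; cases "F y") auto
    have sub: "F y + ereal (\<xi> \<bullet> (z - y)) - ereal (C / 2 * (norm (z - y))\<^sup>2) \<le> F z" for z
    proof -
      have "(L + M / \<epsilon> k) / 2 * (norm (z - y))\<^sup>2 \<le> C / 2 * (norm (z - y))\<^sup>2"
        unfolding C_def using Me by (intro mult_right_mono divide_right_mono add_left_mono) auto
      then have "F y + ereal (\<xi> \<bullet> (z - y)) - ereal (C / 2 * (norm (z - y))\<^sup>2)
          \<le> F y + ereal (\<xi> \<bullet> (z - y)) - ereal ((L + M / \<epsilon> k) / 2 * (norm (z - y))\<^sup>2)"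
        by (simp add: ab)
      also have "\<dots> \<le> F z"
        using step(2)[of z] by (simp add: F_def \<xi>_def)
      finally show ?thesis .
    qed
    have \<xi>: "norm \<xi> \<le> C * r"
    proof -
      have "norm (df y - df (x k)) \<le> L * r"
        using lipschitz_onD[OF f(6) yf x(2)[of k]] by (simp add: r_def dist_norm norm_minus_commute)
      moreover have "norm ((1 / \<epsilon> k) *\<^sub>R (dK k y - dK k (x k))) \<le> M / \<epsilon>lo * r"
      proof -
        have "norm (dK k y - dK k (x k)) \<le> M * r"
          using lipschitz_onD[OF K(4)[of k], of y "x k"]
          by (simp add: r_def dist_norm norm_minus_commute)
        then have "norm ((1 / \<epsilon> k) *\<^sub>R (dK k y - dK k (x k))) \<le> M / \<epsilon> k * r"
          using e by (simp add: divide_right_mono del: scaleR_right_diff_distrib)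
        also have "\<dots> \<le> M / \<epsilon>lo * r"
          using Me by (intro mult_right_mono) (auto simp: r_def)
        finally show ?thesis .
      qed
      ultimately have "norm \<xi> \<le> L * r + M / \<epsilon>lo * r"
        unfolding \<xi>_def by (meson norm_triangle_ineq4 add_mono order_trans)
      then show ?thesis
        by (simp add: C_def algebra_simps)
    qed
    have "b - a \<le> \<kappa> * r\<^sup>2"
    proof (cases "r \<le> 1")
      case False
      have "\<nu> * 1 \<le> \<kappa> * r\<^sup>2"
        using False \<kappa> EB(4) by (intro mult_mono) auto
      then show ?thesis
        using ba by simp
    next
      case True
      have "\<xi> \<in> prox_subdiff F y"
      proof -
        \<comment> \<open>The witnesses are \<open>\<rho> = C / 2\<close> and
          \<open>\<delta> = 1\<close>; the radius is arbitrary because \<open>sub\<close> holds for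
          every \<open>z\<close>.\<close>
        have "y \<in> edom F" and "C / 2 > 0" and "(1::real) > 0"
          using C ab by (simp_all add: edom_def)
        then show ?thesis
          unfolding prox_subdiff_def using sub by blast
      qed
      then have "edist_set 0 (prox_subdiff F y) \<le> ereal (norm \<xi>)"
        unfolding edist_set_def by (intro INF_lower2[of \<xi>]) auto
      also have "\<dots> \<le> ereal (C * r)"
        using \<xi> by simp
      finally have "ereal c * edist_set 0 (prox_subdiff F y) \<le> ereal c * ereal (C * r)"
        using c by (intro ereal_mult_left_mono) auto
      then have pw: "epowr (edist_set y {z. F z \<le> F xbar}) \<gamma> \<le> ereal (c * C * r)"
        using EBc[of y] nb by (simp add: y_def mult.assoc order_trans)
      have nonneg: "0 \<le> edist_set y {z. F z \<le> F xbar}"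
        unfolding edist_set_def by (intro INF_greatest) auto
      \<comment> \<open>\<open>epowr\<close> maps \<open>\<infinity>\<close> to
        \<open>\<infinity>\<close>, so the real bound \<open>pw\<close> forces a finite
        distance.\<close>
      then obtain d where d: "edist_set y {z. F z \<le> F xbar} = ereal d"
        using pw by (cases "edist_set y {z. F z \<le> F xbar}") (auto simp: epowr_def)
      have "0 \<le> d" and "d powr \<gamma> \<le> c * C * r"
        using nonneg pw by (auto simp: d epowr_def)
      then have "d \<le> B * r"
        unfolding B_def using EB(1,2) c C True by (intro le_of_powr_le) (auto simp: r_def)
      then have "d\<^sup>2 \<le> (B * r)\<^sup>2"
        using \<open>0 \<le> d\<close> by (intro power_mono)
      then have "C * (r\<^sup>2 + d\<^sup>2) \<le> C * (r\<^sup>2 + (B * r)\<^sup>2)"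
        using C by (intro mult_left_mono) auto
      moreover have "b - a \<le> C * (r\<^sup>2 + d\<^sup>2)"
        using level_set_gap_le[OF C \<xi> sub ab(2)] d ab(1) by simp
      ultimately have "b - a \<le> C * (1 + B\<^sup>2) * r\<^sup>2"
        by (simp add: algebra_simps power_mult_distrib)
      also have "\<dots> \<le> \<kappa> * r\<^sup>2"
        using \<kappa> by (intro mult_right_mono) auto
      finally show ?thesis .
    qed
    then show ?thesis
      using ab by (simp add: y_def r_def)
  qed
  moreover have "\<kappa> > 0"
    using \<kappa>(1) EB(4) by linarith
  \<comment> \<open>The estimate was shown for every \<open>k\<close> with the original
    \<open>\<eta>\<close> and \<open>\<nu>\<close>; the index 1 only makes \<open>k0\<close>
    positive.\<close>
  ultimately have "\<forall>k\<ge>1. x (Suc k) \<in> level_nbhd F xbar \<eta> \<nu> \<longrightarrow>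
      F (x (Suc k)) - F xbar \<le> ereal (\<kappa> * (norm (x k - x (Suc k)))\<^sup>2)" and "\<kappa> > 0"
    by simp_all
  with EB(3,4) zero_less_one show ?thesis
    by metis
qed

end
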